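(* Let $(X,X^+)$ be an ordered Banach space with total cone and let $T\in\mathcal{L}(X)$ be positive and quasi-compact. Then the following assertions are equivalent: (i) $\operatorname{r}(T) < 1$. (ii) The operator $\mathrm{id}-T: X\to X$ is bijective and $(\mathrm{id}-T)^{-1}$ is positive. (iii) Every $x\in X$ with $Tx \le x$ satisfies $x \ge 0$. (iv) (Small-gain condition) For each $0\neq x \in X^+$ we have $Tx \not\ge x$. (v) For each $x\in X^+$ we have $T^k x \to 0$ as $k\to\infty$. (vi) For each $x \in X^+$ we have $\inf_{k\ge0}\|T^k x\| = 0$.
   Context: An ordered Banach space $(X,X^+)$ is a real Banach space $X$ with a non-empty closed set $X^+$ such that $\alpha X^+ + \beta X^+\subseteq X^+$ for $\alpha,\beta\ge0$ and $X^+\cap(-X^+)=\{0\}$; $x\le y$ means $y-x\in X^+$, and $x\not\ge y$ means $x-y\notin X^+$. The cone is total if $X^+-X^+$ is dense in $X$. $T$ is positive if $TX^+\subseteq X^+$. $T$ is quasi-compact if there exist $n_0\in\mathbb{N}$ and a compact operator $K$ on $X$ with $\|T^{n_0}-K\|<1$ (equivalently, the essential spectral radius of $T$ is $<1$). $\operatorname{r}(T)$ is the spectral radius of (the complexification of) $T$. *)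

theory Defs
  imports "HOL-Analysis.Analysis"
begin

definition ordered_banach_cone :: "('a::banach) set \<Rightarrow> bool" where
  "ordered_banach_cone C \<longleftrightarrow> C \<noteq> {} \<and> closed C \<and>
     (\<forall>a b x y. a \<ge> 0 \<longrightarrow> b \<ge> 0 \<longrightarrow> x \<in> C \<longrightarrow> y \<in> C \<longrightarrow> a *\<^sub>R x + b *\<^sub>R y \<in> C) \<and>
     C \<inter> uminus ` C = {0}"

definition total_cone :: "('a::real_normed_vector) set \<Rightarrow> bool" where
  "total_cone C \<longleftrightarrow> closure {x - y | x y. x \<in> C \<and> y \<in> C} = UNIV"

definition positive_op :: "'a set \<Rightarrow> ('a \<Rightarrow> 'a) \<Rightarrow> bool" where
  "positive_op C T \<longleftrightarrow> T ` C \<subseteq> C"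

definition compact_op :: "('a::real_normed_vector \<Rightarrow> 'a) \<Rightarrow> bool" where
  "compact_op K \<longleftrightarrow> bounded_linear K \<and> compact (closure (K ` ball 0 1))"

definition quasi_compact :: "('a::real_normed_vector \<Rightarrow> 'a) \<Rightarrow> bool" where
  "quasi_compact T \<longleftrightarrow> (\<exists>n0 K. n0 \<ge> 1 \<and> compact_op K \<and> onorm (\<lambda>x. (T ^^ n0) x - K x) < 1)"

text \<open>Complexification \<open>X_C = X \<times> X\<close> (pair (x,y) standing for x + i y). For
  \<open>\<lambda> = a + i b\<close>, the operator \<open>T_C - \<lambda>\<close> acts as
  \<open>(x,y) \<mapsto> (T x - a x + b y, T y - b x - a y)\<close>.\<close>
definition complexified_shift :: "('a::real_normed_vector \<Rightarrow> 'a) \<Rightarrow> complex \<Rightarrow> 'a \<times> 'a \<Rightarrow> 'a \<times> 'a" where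
  "complexified_shift T l = (\<lambda>(x, y).
     (T x - Re l *\<^sub>R x + Im l *\<^sub>R y, T y - Im l *\<^sub>R x - Re l *\<^sub>R y))"

definition invertible_op :: "('b::real_normed_vector \<Rightarrow> 'b) \<Rightarrow> bool" where
  "invertible_op A \<longleftrightarrow> bounded_linear A \<and>
     (\<exists>S. bounded_linear S \<and> (\<forall>z. S (A z) = z) \<and> (\<forall>z. A (S z) = z))"

definition op_spectrum :: "('a::real_normed_vector \<Rightarrow> 'a) \<Rightarrow> complex set" where
  "op_spectrum T = {l. \<not> invertible_op (complexified_shift T l)}"

text \<open>Spectral radius; convention 0 for an empty spectrum (only on the zero space).\<close>
definition spec_radius :: "('a::real_normed_vector \<Rightarrow> 'a) \<Rightarrow> real" where
  "spec_radius T = (if op_spectrum T = {} then 0 else Sup (norm ` op_spectrum T))"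

end

theory Submission
  imports Defs
begin

text \<open>
  The implications (ii) \<open>\<Rightarrow>\<close> (iii) \<open>\<Rightarrow>\<close> (iv) and (v) \<open>\<Rightarrow>\<close> (vi) \<open>\<Rightarrow>\<close> (iv) are elementary.

  (i) \<open>\<Rightarrow>\<close> (ii): the resolvent exists on \<open>[1, \<infinity>)\<close> and is positive for large arguments; the
  resolvent equation exhibits \<open>R(m') x\<close>, for \<open>m' < m\<close> close to \<open>m\<close>, as the fixed point of a contraction
  that preserves the cone, so positivity propagates down to 1.

  (iv) \<open>\<Rightarrow>\<close> (v): if \<open>T\<^sup>k x\<close> does not tend to 0, choose large \<open>k\<close> at which the norm of the orbit is
  comparable to its running maximum. By quasi-compactness \<open>T\<^sup>k x\<close>, normalised, accumulates at some
  nonzero \<open>v\<close> in the cone. The sums of \<open>s\<^sup>i T\<^sup>k\<^sup>-\<^sup>i x\<close> over \<open>i \<le> k\<close>, normalised, are approximate solutions of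
  \<open>T u - u = t T v\<close> as \<open>s\<close> tends to 1 and accumulate at a nonzero \<open>u\<close> in the cone with \<open>T u \<ge> u\<close>.

  (v) \<open>\<Rightarrow>\<close> (i): the orbits vanish asymptotically on a dense subspace. Some power of \<open>T\<close> maps the unit
  ball into finitely many small balls, centred in that subspace; were all powers of norm at least 1,
  this would contradict the choice of a \<open>k\<close> with \<open>T\<^sup>k\<close> of nearly maximal norm among the first powers.
  Hence some power of \<open>T\<close> has norm less than 1, which bounds the spectrum.
\<close>

section \<open>Compactness and growth of sequences\<close>

lemma bounded_linear_funpow:
  fixes T :: "'a::real_normed_vector \<Rightarrow> 'a"
  assumes "bounded_linear T"
  shows "bounded_linear (T ^^ n)"
proof (induction n)
  case 0
  have "T ^^ 0 = (\<lambda>x. x)" by auto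
  then show ?case by (simp only: bounded_linear_ident)
next
  case (Suc n)
  then show ?case
    using bounded_linear_compose[OF assms Suc] by (simp add: o_def)
qed

text \<open>The finitely many terms missed by an eventual cover can serve as extra centres, so the
  range is totally bounded and, by completeness, relatively compact. The eventual form suits orbits:
  \<open>T ^^ k\<close> factors through \<open>T ^^ n\<close> only once
  \<open>k \<ge> n\<close>.\<close>

lemma subseq_convergent_if_totally_bounded:
  fixes f :: "nat \<Rightarrow> 'a::banach"
  assumes "\<And>e. e > 0 \<Longrightarrow> \<exists>F. finite F \<and> (\<forall>\<^sub>F n in sequentially. \<exists>p\<in>F. norm (f n - p) < e)"
  obtains l r where "strict_mono r" "(f \<circ> r) \<longlonglongrightarrow> l"
proof -
  have cover: "\<exists>F. finite F \<and> closure (range f) \<subseteq> (\<Union>p\<in>F. ball p e)" if e: "e > 0" for e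
  proof -
    obtain F m where F: "finite F" "\<And>n. n \<ge> m \<Longrightarrow> \<exists>p\<in>F. norm (f n - p) < e/2"
      using assms[of "e/2"] e unfolding eventually_sequentially by (meson half_gt_zero)
    let ?G = "F \<union> f ` {..<m}"
    have sub: "range f \<subseteq> (\<Union>p\<in>?G. cball p (e/2))"
    proof clarify
      fix n
      show "f n \<in> (\<Union>p\<in>?G. cball p (e/2))"
      proof (cases "n \<ge> m")
        case True
        then show ?thesis using F(2)[of n] by (force simp: dist_norm norm_minus_commute)
      next
        case False
        then show ?thesis using e by (intro UN_I[of "f n"]) auto
      qed
    qed
    have "closed (\<Union>p\<in>?G. cball p (e/2))"
      using F(1) by (intro closed_UN) auto
    then have "closure (range f) \<subseteq> (\<Union>p\<in>?G. cball p (e/2))"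
      using sub by (rule closure_minimal[rotated])
    also have "\<dots> \<subseteq> (\<Union>p\<in>?G. ball p e)"
      using e by (intro UN_mono subset_refl) auto
    finally show ?thesis using F(1) by (intro exI[of _ ?G]) auto
  qed
  have "compact (closure (range f))"
    using cover by (auto simp: compact_eq_totally_bounded complete_eq_closed)
  moreover have "\<forall>n. f n \<in> closure (range f)"
    using closure_subset[of "range f"] by (intro allI) (rule subsetD, auto)
  ultimately obtain l r where "strict_mono r" "(f \<circ> r) \<longlonglongrightarrow> l"
    unfolding compact_def by meson
  then show thesis by (rule that)
qed

text \<open>If \<open>b\<close> is bounded by \<open>M\<close>, every index with
  \<open>b k \<ge> e\<close> works with \<open>d = e / M\<close>, and such indices recur because
  \<open>b\<close> is not null. If \<open>b\<close> is unbounded, genuine records recur and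
  \<open>d = 1\<close> works.\<close>

lemma frequently_almost_record:
  fixes b :: "nat \<Rightarrow> real"
  assumes nonneg: "\<And>k. b k \<ge> 0" and "\<not> b \<longlonglongrightarrow> 0"
  obtains d where "d > 0" "\<And>m. \<exists>k\<ge>m. \<forall>i\<le>k. d * b i \<le> b k"
proof (cases "\<exists>M. \<forall>k. b k \<le> M")
  case True
  then obtain M where M: "\<And>k. b k \<le> M" by blast
  obtain e where e: "e > 0" "\<And>m. \<exists>k\<ge>m. b k \<ge> e"
    using assms by (auto simp: LIMSEQ_def not_less)
  have "M > 0" using e M by (meson less_le_trans)
  have "e / M * b i \<le> b k" if "b k \<ge> e" for i k
  proof -
    have "e / M * b i \<le> e / M * M" using M[of i] e(1) \<open>M > 0\<close> by (intro mult_left_mono) auto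
    then show ?thesis using that \<open>M > 0\<close> by simp
  qed
  then show thesis using e \<open>M > 0\<close> by (intro that[of "e / M"]) (force, meson)
next
  case False
  have "\<exists>k\<ge>m. \<forall>i\<le>k. 1 * b i \<le> b k" for m
  proof -
    let ?B = "Max (b ` {..m})"
    have B: "b i \<le> ?B" if "i \<le> m" for i using that by simp
    obtain j where j: "b j > ?B" using False by (meson not_le)
    \<comment> \<open>The first index whose value exceeds the maximum over \<open>{..m}\<close> is a
      record, and it must lie beyond \<open>m\<close>.\<close>
    define k where "k = (LEAST j. b j > ?B)"
    have k: "b k > ?B" unfolding k_def by (rule LeastI[of _ j]) fact
    have "b i \<le> ?B" if "i < k" for i
      using not_less_Least[of i "\<lambda>j. b j > ?B"] that unfolding k_def by (meson not_le)
    then have "\<forall>i\<le>k. b i \<le> b k" using k by (metis le_less order.strict_trans1)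
    moreover have "k \<ge> m" using k B[of k] by linarith
    ultimately show ?thesis by auto
  qed
  then show thesis by (intro that[of 1]) auto
qed

section \<open>Finite covers and quasi-compactness\<close>

text \<open>A finite net for the compact part of \<open>T ^^ N\<close> covers the image of the unit
  ball with precision \<open>r < 1\<close>. The remaining error, rescaled to the unit ball, can be
  treated in the same way, so precisions multiply under iteration.\<close>

lemma quasi_compact_unit_ball_cover:
  assumes T: "bounded_linear T" and "quasi_compact T"
  obtains N r where "0 < r" "r < 1"
    "\<And>m. \<exists>F. finite F \<and> (\<forall>z. norm z < 1 \<longrightarrow> (\<exists>p\<in>F. norm ((T ^^ (m * N)) z - p) < r ^ m))"
proof -
  obtain N K where K: "compact_op K" "onorm (\<lambda>x. (T ^^ N) x - K x) < 1"
    using assms(2) unfolding quasi_compact_def by blast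
  define s where "s = onorm (\<lambda>x. (T ^^ N) x - K x)"
  \<comment> \<open>The midpoint of \<open>s\<close> and 1: it leaves \<open>(1 - s) / 2\<close> for
    the precision of the net of the compact part.\<close>
  define r where "r = (1 + s) / 2"
  interpret TN: bounded_linear "T ^^ N" by (rule bounded_linear_funpow[OF T])
  have blK: "bounded_linear K" using K(1) unfolding compact_op_def by simp
  have blS: "bounded_linear (\<lambda>x. (T ^^ N) x - K x)"
    by (intro bounded_linear_sub TN.bounded_linear_axioms blK)
  have s: "0 \<le> s" "s < 1" using onorm_pos_le[OF blS] K(2) unfolding s_def by auto
  then have r: "0 < r" "r < 1" "s + (1 - s) / 2 = r" unfolding r_def by (auto simp: field_simps)
  obtain G where G: "finite G" "closure (K ` ball 0 1) \<subseteq> (\<Union>p\<in>G. ball p ((1 - s)/2))"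
    using K(1) s unfolding compact_op_def compact_eq_totally_bounded
    by (metis diff_gt_0_iff_gt half_gt_zero)
  have step: "\<exists>p\<in>G. norm ((T ^^ N) w - p) < r" if "norm w < 1" for w
  proof -
    have "K w \<in> closure (K ` ball 0 1)" using that closure_subset by force
    then obtain p where p: "p \<in> G" "norm (K w - p) < (1 - s)/2"
      using G(2) by (force simp: dist_norm norm_minus_commute)
    have "norm ((T ^^ N) w - K w) \<le> s * norm w" unfolding s_def by (rule onorm[OF blS])
    also have "\<dots> \<le> s" using that s by (simp add: mult_left_le)
    finally have "norm ((T ^^ N) w - p) < s + (1 - s)/2"
      using p(2) norm_triangle_ineq[of "(T ^^ N) w - K w" "K w - p"]
      by (simp only: diff_add_cancel add_diff_eq)
    then show ?thesis using p(1) r(3) by auto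
  qed
  have "\<exists>F. finite F \<and> (\<forall>z. norm z < 1 \<longrightarrow> (\<exists>p\<in>F. norm ((T ^^ (m * N)) z - p) < r ^ m))" for m
  proof (induction m)
    case 0
    show ?case by (intro exI[of _ "{0}"]) auto
  next
    case (Suc m)
    then obtain F where F: "finite F"
      "\<And>z. norm z < 1 \<Longrightarrow> \<exists>p\<in>F. norm ((T ^^ (m * N)) z - p) < r ^ m" by blast
    \<comment> \<open>With \<open>(T ^^ (m * N)) z = p + r ^ m *\<^sub>R w\<close> and
      \<open>norm w < 1\<close>, another \<open>T ^^ N\<close> maps \<open>p\<close> to
      \<open>(T ^^ N) p\<close> and puts the image of \<open>w\<close> near some \<open>q\<close> in
      \<open>G\<close>.\<close>
    let ?F = "(\<lambda>(p, q). (T ^^ N) p + r ^ m *\<^sub>R q) ` (F \<times> G)"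
    have "\<exists>p\<in>?F. norm ((T ^^ (Suc m * N)) z - p) < r ^ Suc m" if z: "norm z < 1" for z
    proof -
      obtain p where p: "p \<in> F" "norm ((T ^^ (m * N)) z - p) < r ^ m" using F(2)[OF z] by blast
      define w where "w = (1 / r ^ m) *\<^sub>R ((T ^^ (m * N)) z - p)"
      have "norm w < 1" using p(2) r(1) unfolding w_def by simp
      then obtain q where q: "q \<in> G" "norm ((T ^^ N) w - q) < r" using step by blast
      have "(T ^^ (m * N)) z = p + r ^ m *\<^sub>R w" using r(1) unfolding w_def by simp
      then have "(T ^^ (Suc m * N)) z = (T ^^ N) p + r ^ m *\<^sub>R (T ^^ N) w"
        by (simp add: funpow_add TN.add TN.scaleR)
      then have "(T ^^ (Suc m * N)) z - ((T ^^ N) p + r ^ m *\<^sub>R q) = r ^ m *\<^sub>R ((T ^^ N) w - q)"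
        by (simp add: algebra_simps)
      then have "norm ((T ^^ (Suc m * N)) z - ((T ^^ N) p + r ^ m *\<^sub>R q)) < r ^ Suc m"
        using q(2) r(1) by simp
      then show ?thesis using p(1) q(1) by force
    qed
    then show ?case using F(1) G(1) by (intro exI[of _ ?F]) auto
  qed
  with r show thesis using that by blast
qed

lemma quasi_compact_cover:
  assumes T: "bounded_linear T" and "quasi_compact T" and "e > 0"
  obtains n F where "finite F" "\<And>z. norm z \<le> M \<Longrightarrow> \<exists>p\<in>F. norm ((T ^^ n) z - p) < e"
proof -
  \<comment> \<open>Clipping at 0 keeps \<open>B\<close> positive even for negative
    \<open>M\<close>; the added 1 places the rescaled vectors strictly inside the unit ball.\<close>
  define B where "B = max M 0 + 1"
  have B: "B > 0" "M < B" unfolding B_def by auto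
  obtain N r where r: "0 < r" "r < 1" and cov:
    "\<And>m. \<exists>F. finite F \<and> (\<forall>z. norm z < 1 \<longrightarrow> (\<exists>p\<in>F. norm ((T ^^ (m * N)) z - p) < r ^ m))"
    using quasi_compact_unit_ball_cover[OF assms(1,2)] by metis
  obtain m where m: "r ^ m < e / B"
    using real_arch_pow_inv[of "e/B" r] r B \<open>e > 0\<close> by auto
  obtain F where F: "finite F" "\<And>z. norm z < 1 \<Longrightarrow> \<exists>p\<in>F. norm ((T ^^ (m * N)) z - p) < r ^ m"
    using cov[of m] by blast
  interpret bounded_linear "T ^^ (m * N)" by (rule bounded_linear_funpow[OF T])
  have "\<exists>p\<in>(\<lambda>p. B *\<^sub>R p) ` F. norm ((T ^^ (m * N)) z - p) < e" if "norm z \<le> M" for z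
  proof -
    have "norm ((1/B) *\<^sub>R z) < 1" using that B by simp
    then obtain p where p: "p \<in> F" "norm ((T ^^ (m * N)) ((1/B) *\<^sub>R z) - p) < r ^ m" using F(2) by blast
    have "(T ^^ (m * N)) z - B *\<^sub>R p = B *\<^sub>R ((T ^^ (m * N)) ((1/B) *\<^sub>R z) - p)"
      using B by (simp add: scaleR scaleR_diff_right)
    then have "norm ((T ^^ (m * N)) z - B *\<^sub>R p) < B * r ^ m" using p(2) B by simp
    also have "\<dots> < e" using m B by (simp add: field_simps)
    finally show ?thesis using p(1) by blast
  qed
  then show thesis using that F(1) by blast
qed

text \<open>Convergence of \<open>T (u j) - u j\<close> passes to
  \<open>(T ^^ n) (u j) - u j\<close> for every fixed \<open>n\<close>. Up to a null sequence,
  \<open>u j\<close> is therefore a translate of \<open>(T ^^ n) (u j)\<close>, which lies in a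
  finite union of small balls.\<close>

lemma quasi_compact_asymptotic_fixed_subseq:
  fixes T :: "'a::banach \<Rightarrow> 'a"
  assumes T: "bounded_linear T" and qc: "quasi_compact T"
    and bd: "\<And>j. norm (u j) \<le> M" and lim: "(\<lambda>j. T (u j) - u j) \<longlonglongrightarrow> h"
  obtains l r where "strict_mono r" "(u \<circ> r) \<longlonglongrightarrow> l"
proof (rule subseq_convergent_if_totally_bounded)
  fix e :: real assume "e > 0"
  have conv: "convergent (\<lambda>j. (T ^^ n) (u j) - u j)" for n
  proof (induction n)
    case 0
    show ?case by (simp add: convergent_const)
  next
    case (Suc n)
    have "(T ^^ Suc n) (u j) - u j = T ((T ^^ n) (u j) - u j) + (T (u j) - u j)" for j
      by (simp add: linear_diff[OF bounded_linear.linear[OF T]])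
    moreover have "convergent (\<lambda>j. T ((T ^^ n) (u j) - u j))"
      using bounded_linear.tendsto[OF T] Suc unfolding convergent_def by blast
    ultimately show ?case using convergent_add[OF _ convergentI[OF lim]] by (simp only:)
  qed
  obtain n F where F: "finite F" "\<And>z. norm z \<le> M \<Longrightarrow> \<exists>p\<in>F. norm ((T ^^ n) z - p) < e/2"
    using quasi_compact_cover[OF T qc, of "e/2" M] \<open>e > 0\<close> by (metis half_gt_zero)
  obtain g where g: "(\<lambda>j. (T ^^ n) (u j) - u j) \<longlonglongrightarrow> g" using conv unfolding convergent_def by blast
  have "\<forall>\<^sub>F j in sequentially. norm ((T ^^ n) (u j) - u j - g) < e/2"
    using tendstoD[OF g, of "e/2"] \<open>e > 0\<close> by (simp add: dist_norm)
  then have "\<forall>\<^sub>F j in sequentially. \<exists>p\<in>(\<lambda>p. p - g) ` F. norm (u j - p) < e"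
  proof eventually_elim
    case (elim j)
    obtain p where p: "p \<in> F" "norm ((T ^^ n) (u j) - p) < e/2" using F(2)[OF bd] by blast
    have "u j - (p - g) = ((T ^^ n) (u j) - p) - ((T ^^ n) (u j) - u j - g)" by simp
    then have "norm (u j - (p - g)) \<le> norm ((T ^^ n) (u j) - p) + norm ((T ^^ n) (u j) - u j - g)"
      using norm_triangle_ineq4 by metis
    then have "norm (u j - (p - g)) < e" using p(2) elim by linarith
    then show ?case using p(1) by blast
  qed
  then show "\<exists>F. finite F \<and> (\<forall>\<^sub>F j in sequentially. \<exists>p\<in>F. norm (u j - p) < e)"
    using F(1) by blast
qed (use that in blast)

lemma quasi_compact_power_contraction:
  fixes T :: "'a::banach \<Rightarrow> 'a"
  assumes T: "bounded_linear T" and qc: "quasi_compact T"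
    and dense: "closure D = UNIV" and lim: "\<And>x. x \<in> D \<Longrightarrow> (\<lambda>k. (T ^^ k) x) \<longlonglongrightarrow> 0"
  shows "\<exists>n\<ge>1. onorm (T ^^ n) < 1"
proof (rule ccontr)
  assume "\<not> ?thesis"
  then have ge1: "onorm (T ^^ n) \<ge> 1" if "n \<ge> 1" for n using that by (meson not_le)
  note bl = bounded_linear_funpow[OF T]
  have "\<not> (\<lambda>k. onorm (T ^^ k)) \<longlonglongrightarrow> 0"
  proof
    assume "(\<lambda>k. onorm (T ^^ k)) \<longlonglongrightarrow> 0"
    moreover have "\<forall>\<^sub>F k in sequentially. onorm (T ^^ k) \<ge> 1"
      using ge1 unfolding eventually_sequentially by blast
    ultimately have "(0::real) \<ge> 1"
      by (intro tendsto_lowerbound[of _ 0 sequentially]) auto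
    then show False by simp
  qed
  then obtain d where d: "d > 0" "\<And>m. \<exists>k\<ge>m. \<forall>i\<le>k. d * onorm (T ^^ i) \<le> onorm (T ^^ k)"
    using frequently_almost_record[of "\<lambda>k. onorm (T ^^ k)"] onorm_pos_le[OF bl] by metis
  \<comment> \<open>The bound \<open>d/4\<close> here and again for \<open>q\<close> adds up to
    \<open>d/2\<close>; an almost record \<open>k\<close> gives
    \<open>onorm (T ^^ (k - n)) \<le> a / d\<close>, so the product is at most
    \<open>a / 2\<close>.\<close>
  obtain n F where F: "finite F" "\<And>z. norm z \<le> 1 \<Longrightarrow> \<exists>p\<in>F. norm ((T ^^ n) z - p) < d/4"
    using quasi_compact_cover[OF T qc, of "d/4" 1] d(1) by (metis divide_pos_pos zero_less_numeral)
  \<comment> \<open>The centres in \<open>F\<close> may lie outside \<open>D\<close>, where nothing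
    is known about their orbits, so each is replaced by a nearby point of \<open>D\<close>.\<close>
  have "\<exists>q\<in>D. norm (p - q) < d/4" for p
  proof -
    have "p \<in> closure D" using dense by simp
    then show ?thesis using d(1) unfolding closure_approachable
      by (metis dist_commute dist_norm divide_pos_pos zero_less_numeral)
  qed
  then obtain q where q: "\<And>p. q p \<in> D" "\<And>p. norm (p - q p) < d/4" by metis
  have "\<forall>\<^sub>F k in sequentially. norm ((T ^^ k) (q p)) < 1/4" for p
    using tendstoD[OF lim[OF q(1)[of p]], of "1/4"] by simp
  then have "\<forall>\<^sub>F k in sequentially. \<forall>p\<in>F. norm ((T ^^ k) (q p)) < 1/4"
    using F(1) by (intro eventually_ball_finite) auto
  then obtain k0 where k0: "\<And>k p. k \<ge> k0 \<Longrightarrow> p \<in> F \<Longrightarrow> norm ((T ^^ k) (q p)) < 1/4"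
    unfolding eventually_sequentially by blast
  \<comment> \<open>The size of \<open>k\<close> allows splitting off \<open>T ^^ n\<close>, leaves
    \<open>k - n \<ge> k0\<close> further steps for the centres, and ensures
    \<open>k \<ge> 1\<close>, hence \<open>a \<ge> 1\<close>.\<close>
  obtain k where k: "k \<ge> k0 + n + 1" "\<And>i. i \<le> k \<Longrightarrow> d * onorm (T ^^ i) \<le> onorm (T ^^ k)"
    using d(2) by meson
  define a where "a = onorm (T ^^ k)"
  have a: "a \<ge> 1" unfolding a_def using k(1) by (intro ge1) simp
  interpret P: bounded_linear "T ^^ (k - n)" by (rule bl)
  have unit: "norm ((T ^^ k) z) \<le> 3/4 * a" if z: "norm z \<le> 1" for z
  proof -
    obtain p where p: "p \<in> F" "norm ((T ^^ n) z - p) < d/4" using F(2)[OF z] by blast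
    have "norm ((T ^^ n) z - q p) \<le> d/2"
      using norm_triangle_ineq[of "(T ^^ n) z - p" "p - q p"] p(2) q(2)[of p] by simp
    then have "norm ((T ^^ (k - n)) ((T ^^ n) z - q p)) \<le> onorm (T ^^ (k - n)) * (d/2)"
      using onorm[OF bl, of "k - n" "(T ^^ n) z - q p"] onorm_pos_le[OF bl, of "k - n"]
      by (meson mult_left_mono order_trans)
    also have "\<dots> \<le> a / 2" using k(2)[of "k - n"] unfolding a_def by (simp add: mult.commute)
    finally have 1: "norm ((T ^^ (k - n)) ((T ^^ n) z - q p)) \<le> a / 2" .
    have 2: "norm ((T ^^ (k - n)) (q p)) < 1/4" using k0 k(1) p(1) by simp
    have "T ^^ k = T ^^ (k - n) \<circ> T ^^ n" using k(1) by (simp flip: funpow_add)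
    then have "(T ^^ k) z = (T ^^ (k - n)) ((T ^^ n) z - q p) + (T ^^ (k - n)) (q p)"
      by (simp add: P.diff)
    then have "norm ((T ^^ k) z) \<le> a/2 + 1/4"
      using 1 2 norm_triangle_ineq[of "(T ^^ (k - n)) ((T ^^ n) z - q p)" "(T ^^ (k - n)) (q p)"] by simp
    then show ?thesis using a by simp
  qed
  interpret Tk: bounded_linear "T ^^ k" by (rule bl)
  have "norm ((T ^^ k) z) \<le> 3/4 * a * norm z" for z
  proof (cases "z = 0")
    case False
    then show ?thesis using unit[of "(1 / norm z) *\<^sub>R z"] by (simp add: Tk.scaleR field_simps)
  qed (simp add: Tk.zero)
  then have "onorm (T ^^ k) \<le> 3/4 * a" using a by (intro onorm_bound) simp_all
  then show False using a unfolding a_def by linarith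
qed

section \<open>Cones, contractions and Neumann inverses\<close>

lemma
  assumes "ordered_banach_cone C"
  shows cone_closed: "closed C" and cone_zero: "0 \<in> C"
    and cone_add: "x \<in> C \<Longrightarrow> y \<in> C \<Longrightarrow> x + y \<in> C"
    and cone_scale: "a \<ge> 0 \<Longrightarrow> x \<in> C \<Longrightarrow> a *\<^sub>R x \<in> C"
    and cone_pointed: "x \<in> C \<Longrightarrow> - x \<in> C \<Longrightarrow> x = 0"
proof -
  have lin: "a *\<^sub>R x + b *\<^sub>R y \<in> C" if "a \<ge> 0" "b \<ge> 0" "x \<in> C" "y \<in> C" for a b x y
    using assms that unfolding ordered_banach_cone_def by blast
  have int: "C \<inter> uminus ` C = {0}" and "closed C"
    using assms unfolding ordered_banach_cone_def by blast+
  then show "closed C" "0 \<in> C" by blast+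
  show "x \<in> C \<Longrightarrow> y \<in> C \<Longrightarrow> x + y \<in> C" using lin[of 1 1 x y] by simp
  show "a \<ge> 0 \<Longrightarrow> x \<in> C \<Longrightarrow> a *\<^sub>R x \<in> C" using lin[of a 0 x x] by simp
  assume "x \<in> C" "- x \<in> C"
  then have "x \<in> C \<inter> uminus ` C" by (metis IntI image_eqI minus_minus)
  then show "x = 0" using int by simp
qed

lemma contraction_fixpoint_zero:
  fixes w :: "'a::real_normed_vector"
  assumes "norm w \<le> c * norm w" "c < 1"
  shows "w = 0"
proof (rule ccontr)
  assume "w \<noteq> 0"
  then have "c * norm w < 1 * norm w" using assms(2) by (intro mult_strict_right_mono) auto
  then show False using assms(1) by simp
qed

text \<open>The affine map \<open>w \<mapsto> z + A w\<close> is a contraction of the complete set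
  \<open>C\<close>, so it has a fixed point there; uniqueness in the whole space identifies it with
  \<open>y\<close>.\<close>

lemma positive_contraction_fixpoint:
  fixes C :: "'a::banach set"
  assumes C: "ordered_banach_cone C" and A: "bounded_linear A" and pos: "\<And>x. x \<in> C \<Longrightarrow> A x \<in> C"
    and c: "\<And>w. norm (A w) \<le> c * norm w" "0 \<le> c" "c < 1" and z: "z \<in> C" and y: "y = z + A y"
  shows "y \<in> C"
proof -
  interpret bounded_linear A by (rule A)
  have "\<exists>!w. w \<in> C \<and> z + A w = w"
  proof (rule Banach_fix[OF _ _ c(2,3)])
    show "complete C" using cone_closed[OF C] by (simp add: complete_eq_closed)
    show "C \<noteq> {}" using z by blast
    show "(\<lambda>w. z + A w) ` C \<subseteq> C" using pos z cone_add[OF C] by auto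
    show "dist (z + A v) (z + A w) \<le> c * dist v w" for v w
      using c(1)[of "v - w"] by (simp add: dist_norm diff)
  qed
  then obtain w where w: "w \<in> C" "z + A w = w" by blast
  have "y - w = A (y - w)" using y w(2) by (metis add_diff_cancel_left diff)
  then have "y - w = 0" using contraction_fixpoint_zero[of "y - w" c] c(1)[of "y - w"] c(3) by simp
  then show ?thesis using w(1) by simp
qed

text \<open>Instead of a series, \<open>S y\<close> is the fixed point of the contraction
  \<open>w \<mapsto> y + B w\<close>; linearity of \<open>S\<close> follows from uniqueness.\<close>

lemma neumann_inverse:
  fixes B :: "'a::banach \<Rightarrow> 'a"
  assumes B: "bounded_linear B" and c: "\<And>w. norm (B w) \<le> c * norm w" "0 \<le> c" "c < 1"
  shows "\<exists>S. bounded_linear S \<and> (\<forall>z. S (z - B z) = z) \<and> (\<forall>z. S z - B (S z) = z)"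
proof -
  interpret bounded_linear B by (rule B)
  have uniq: "v = w" if "v - B v = w - B w" for v w
  proof -
    have "v - w = B (v - w)" using that by (simp add: diff algebra_simps)
    then have "v - w = 0" using contraction_fixpoint_zero[of "v - w" c] c(1)[of "v - w"] c(3) by simp
    then show ?thesis by simp
  qed
  have "\<exists>w. w - B w = y" for y
  proof -
    have "\<exists>!w. w \<in> UNIV \<and> y + B w = w"
    proof (rule Banach_fix[OF _ _ c(2,3)])
      show "dist (y + B v) (y + B w) \<le> c * dist v w" for v w
        using c(1)[of "v - w"] by (simp add: dist_norm diff)
    qed (auto simp: complete_UNIV)
    then show ?thesis by (metis add_diff_cancel_right')
  qed
  then obtain S where S: "\<And>y. S y - B (S y) = y" by metis
  have "bounded_linear S"
  proof (rule bounded_linear_intro[where K = "1 / (1 - c)"])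
    show "S (x + y) = S x + S y" for x y
    proof (rule uniq)
      have "S x + S y - B (S x + S y) = (S x - B (S x)) + (S y - B (S y))" by (simp add: add)
      then show "S (x + y) - B (S (x + y)) = S x + S y - B (S x + S y)" by (simp add: S)
    qed
    show "S (r *\<^sub>R x) = r *\<^sub>R S x" for r x
    proof (rule uniq)
      have "r *\<^sub>R S x - B (r *\<^sub>R S x) = r *\<^sub>R (S x - B (S x))"
        by (simp add: scaleR scaleR_diff_right)
      then show "S (r *\<^sub>R x) - B (S (r *\<^sub>R x)) = r *\<^sub>R S x - B (r *\<^sub>R S x)" by (simp add: S)
    qed
    show "norm (S x) \<le> norm x * (1 / (1 - c))" for x
    proof -
      have "norm (S x) \<le> norm x + norm (B (S x))"
        using norm_triangle_ineq[of x "B (S x)"] S[of x] by (simp add: diff_eq_eq)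
      then have "norm (S x) * (1 - c) \<le> norm x" using c(1)[of "S x"] by (simp add: algebra_simps)
      then show ?thesis using c(3) by (simp add: field_simps)
    qed
  qed
  then show ?thesis using S uniq by blast
qed

text \<open>The geometric sum \<open>G\<close> satisfies \<open>(id - Q) G = id - Q ^^ k\<close>, so
  \<open>G\<close> after the inverse of \<open>id - Q ^^ k\<close> is a right inverse of
  \<open>id - Q\<close>. It is also a left inverse because fixed vectors of \<open>Q\<close> are
  fixed by \<open>Q ^^ k\<close> and hence vanish.\<close>

lemma neumann_inverse_power:
  fixes Q :: "'a::banach \<Rightarrow> 'a"
  assumes Q: "bounded_linear Q" and c: "\<And>w. norm ((Q ^^ k) w) \<le> c * norm w" "0 \<le> c" "c < 1"
  shows "\<exists>S. bounded_linear S \<and> (\<forall>z. S (z - Q z) = z) \<and> (\<forall>z. S z - Q (S z) = z)"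
proof -
  interpret bounded_linear Q by (rule Q)
  obtain S where S: "bounded_linear S" "\<And>z. S (z - (Q ^^ k) z) = z" "\<And>z. S z - (Q ^^ k) (S z) = z"
    using neumann_inverse[OF bounded_linear_funpow[OF Q] c] by blast
  define G where "G z = (\<Sum>i<k. (Q ^^ i) z)" for z
  have "bounded_linear G" unfolding G_def by (intro bounded_linear_sum bounded_linear_funpow[OF Q])
  then have bl: "bounded_linear (\<lambda>z. G (S z))" using S(1) by (rule bounded_linear_compose)
  have G: "G z - Q (G z) = z - (Q ^^ k) z" for z
  proof -
    have "G z - Q (G z) = (\<Sum>i<k. (Q ^^ i) z - (Q ^^ Suc i) z)"
      unfolding G_def by (simp add: sum sum_subtractf)
    also have "\<dots> = (Q ^^ 0) z - (Q ^^ k) z" by (rule sum_lessThan_telescope')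
    finally show ?thesis by simp
  qed
  have right: "G (S z) - Q (G (S z)) = z" for z using G[of "S z"] S(3)[of z] by simp
  have inj: "v = w" if "v - Q v = w - Q w" for v w
  proof -
    have fix1: "Q (v - w) = v - w" using that by (simp add: diff algebra_simps)
    have "(Q ^^ i) (v - w) = v - w" for i by (induction i) (simp_all add: fix1)
    then have "v - w = S 0" using S(2)[of "v - w"] by simp
    then show ?thesis using linear_0[OF bounded_linear.linear[OF S(1)]] by simp
  qed
  have left: "G (S (z - Q z)) = z" for z by (rule inj) (rule right)
  show ?thesis by (rule exI[of _ "\<lambda>z. G (S z)"]) (use bl left right in simp)
qed

section \<open>Complexification and spectral radius\<close>

text \<open>Multiplication by a complex scalar on the complexification, whose type
  \<open>'a \<times> 'a\<close> carries only the real structure.\<close>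

definition complex_scale :: "complex \<Rightarrow> 'a::real_normed_vector \<times> 'a \<Rightarrow> 'a \<times> 'a" where
  "complex_scale l z =
     (Re l *\<^sub>R fst z - Im l *\<^sub>R snd z, Im l *\<^sub>R fst z + Re l *\<^sub>R snd z)"

lemma complex_scale_mult: "complex_scale l (complex_scale m z) = complex_scale (l * m) z"
  by (simp add: complex_scale_def algebra_simps)

lemma complex_scale_one [simp]: "complex_scale 1 z = z"
  by (simp add: complex_scale_def)

lemma bounded_linear_complex_scale: "bounded_linear (complex_scale l)"
  unfolding complex_scale_def
  by (intro bounded_linear_Pair bounded_linear_add bounded_linear_sub
      bounded_linear_const_scaleR bounded_linear_fst bounded_linear_snd)

text \<open>The product norm need not be homogeneous under complex scalars, so only an estimate up
  to a constant is given; high powers absorb the constant later.\<close>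

lemma norm_complex_scale_le: "norm (complex_scale l z) \<le> 2 * norm l * (norm (fst z) + norm (snd z))"
proof -
  have 1: "norm (Re l *\<^sub>R fst z - Im l *\<^sub>R snd z) \<le> norm l * norm (fst z) + norm l * norm (snd z)"
    by (rule norm_triangle_le_diff) (simp add: add_mono mult_right_mono abs_Re_le_cmod abs_Im_le_cmod)
  have 2: "norm (Im l *\<^sub>R fst z + Re l *\<^sub>R snd z) \<le> norm l * norm (fst z) + norm l * norm (snd z)"
    by (rule norm_triangle_le) (simp add: add_mono mult_right_mono abs_Re_le_cmod abs_Im_le_cmod)
  have "norm (complex_scale l z) \<le> norm (Re l *\<^sub>R fst z - Im l *\<^sub>R snd z) + norm (Im l *\<^sub>R fst z + Re l *\<^sub>R snd z)"
    unfolding complex_scale_def by (rule norm_Pair_le)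
  also have "\<dots> \<le> 2 * norm l * (norm (fst z) + norm (snd z))" using 1 2 by (simp add: algebra_simps)
  finally show ?thesis .
qed

lemma onorm_funpow_le:
  fixes T :: "'a::real_normed_vector \<Rightarrow> 'a"
  assumes "bounded_linear T"
  shows "norm ((T ^^ m) x) \<le> onorm T ^ m * norm x"
proof (induction m)
  case (Suc m)
  have "norm ((T ^^ Suc m) x) \<le> onorm T * norm ((T ^^ m) x)"
    using onorm[OF assms, of "(T ^^ m) x"] by simp
  also have "\<dots> \<le> onorm T * (onorm T ^ m * norm x)"
    using Suc onorm_pos_le[OF assms] by (rule mult_left_mono)
  finally show ?case by (simp add: mult.assoc)
qed simp

text \<open>The shift equals \<open>l\<close> times \<open>Q - id\<close>, where \<open>Q\<close> is
  the complexified \<open>T\<close> divided by \<open>l\<close>. Powers of \<open>Q\<close> decay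
  geometrically up to a constant, so some power is a contraction and \<open>id - Q\<close> is
  invertible.\<close>

lemma invertible_complexified_shift:
  fixes T :: "'a::banach \<Rightarrow> 'a"
  assumes T: "bounded_linear T" and n: "n \<ge> 1" "onorm (T ^^ n) < norm l ^ n"
  shows "invertible_op (complexified_shift T l)"
proof -
  interpret bounded_linear T by (rule T)
  note bl = bounded_linear_funpow[OF T]
  define TT where "TT z = (T (fst z), T (snd z))" for z
  define Q where "Q z = complex_scale (1 / l) (TT z)" for z
  have l: "l \<noteq> 0" using n onorm_pos_le[OF bl, of n] by (auto simp: power_0_left)
  have blTT: "bounded_linear TT"
    unfolding TT_def by (intro bounded_linear_Pair bounded_linear_compose[OF T]
      bounded_linear_fst bounded_linear_snd)
  have blQ: "bounded_linear Q"
    unfolding Q_def by (intro bounded_linear_compose[OF bounded_linear_complex_scale] blTT)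
  have comm: "TT (complex_scale m z) = complex_scale m (TT z)" for m z
    by (simp add: TT_def complex_scale_def diff add scaleR)
  have Qpow: "(Q ^^ k) z = complex_scale ((1 / l) ^ k) ((T ^^ k) (fst z), (T ^^ k) (snd z))" for k z
  proof (induction k)
    case (Suc k)
    then have "(Q ^^ Suc k) z =
        complex_scale (1 / l) (complex_scale ((1 / l) ^ k) (TT ((T ^^ k) (fst z), (T ^^ k) (snd z))))"
      using Q_def[of "(Q ^^ k) z"] by (simp add: comm)
    then show ?case by (simp add: complex_scale_mult TT_def)
  qed simp
  define q where "q = onorm (T ^^ n) / norm l ^ n"
  have q: "0 \<le> q" "q < 1" using n l onorm_pos_le[OF bl, of n] by (auto simp: q_def)
  \<comment> \<open>The threshold \<open>1/4\<close> beats the factor 4: a 2 from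
    \<open>norm_complex_scale_le\<close> and a 2 from bounding both components by
    \<open>norm z\<close>.\<close>
  obtain m where m: "q ^ m < 1 / 4" using real_arch_pow_inv[of "1/4" q] q by auto
  have "norm ((Q ^^ (n * m)) z) \<le> 4 * q ^ m * norm z" for z
  proof -
    have pow: "norm ((T ^^ (n * m)) x) \<le> onorm (T ^^ n) ^ m * norm x" for x
      using onorm_funpow_le[OF bl, of m n x] by (simp add: funpow_mult)
    have "norm ((Q ^^ (n * m)) z) \<le>
        2 * (1 / norm l) ^ (n * m) * (norm ((T ^^ (n * m)) (fst z)) + norm ((T ^^ (n * m)) (snd z)))"
      unfolding Qpow using norm_complex_scale_le[of "(1 / l) ^ (n * m)"] 
      by (metis fst_conv norm_divide norm_one norm_power snd_conv)
    also have "\<dots> \<le> 2 * (1 / norm l) ^ (n * m) *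
        (onorm (T ^^ n) ^ m * norm z + onorm (T ^^ n) ^ m * norm z)"
      using onorm_pos_le[OF bl, of n] norm_fst_le[of "fst z" "snd z"] norm_snd_le[of "snd z" "fst z"]
      by (intro mult_left_mono add_mono order_trans[OF pow]) auto
    also have "\<dots> = 4 * q ^ m * norm z"
      by (simp add: q_def power_divide power_mult)
    finally show ?thesis .
  qed
  then obtain S where S: "bounded_linear S" "\<And>z. S (z - Q z) = z" "\<And>z. S z - Q (S z) = z"
    using neumann_inverse_power[OF blQ, of "n * m" "4 * q ^ m"] q m by auto
  have shift: "complexified_shift T l z = TT z - complex_scale l z" for z
    by (cases z) (simp add: complexified_shift_def TT_def complex_scale_def algebra_simps)
  interpret cs: bounded_linear "complex_scale m" for m by (rule bounded_linear_complex_scale)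
  have shift': "complexified_shift T l z = complex_scale l (Q z - z)" for z
    using l by (simp add: shift Q_def cs.diff complex_scale_mult)
  define V where "V z = S (- complex_scale (1 / l) z)" for z
  have "bounded_linear V" unfolding V_def
    by (intro bounded_linear_compose[OF S(1)] bounded_linear_minus bounded_linear_complex_scale)
  moreover have "bounded_linear (complexified_shift T l)"
    unfolding shift by (intro bounded_linear_sub blTT bounded_linear_complex_scale)
  moreover have "V (complexified_shift T l z) = z" for z
    using S(2)[of z] l by (simp add: V_def shift' complex_scale_mult)
  moreover have "complexified_shift T l (V z) = z" for z
  proof -
    have "Q (V z) - V z = complex_scale (1 / l) z"
      using S(3)[of "- complex_scale (1 / l) z"] unfolding V_def by (metis minus_diff_eq minus_minus)
    then show ?thesis using l by (simp add: shift' complex_scale_mult)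
  qed
  ultimately show ?thesis unfolding invertible_op_def by blast
qed

lemma op_spectrum_power_bound:
  fixes T :: "'a::banach \<Rightarrow> 'a"
  assumes "bounded_linear T" "n \<ge> 1" "l \<in> op_spectrum T"
  shows "norm l ^ n \<le> onorm (T ^^ n)"
  using invertible_complexified_shift[OF assms(1,2), of l] assms(3)
  unfolding op_spectrum_def by (meson mem_Collect_eq not_le)

text \<open>A supremum of numbers below 1 may equal 1, so a uniform bound over the spectrum is used,
  namely the \<open>n\<close>-th root of \<open>onorm (T ^^ n)\<close>. An empty spectrum has radius
  0 by convention.\<close>

lemma spec_radius_less_oneI:
  fixes T :: "'a::banach \<Rightarrow> 'a"
  assumes T: "bounded_linear T" and n: "n \<ge> 1" "onorm (T ^^ n) < 1"
  shows "spec_radius T < 1"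
proof (cases "op_spectrum T = {}")
  case False
  have "Sup (norm ` op_spectrum T) \<le> root n (onorm (T ^^ n))"
  proof (rule cSup_least)
    fix t assume "t \<in> norm ` op_spectrum T"
    then obtain l where "l \<in> op_spectrum T" "t = norm l" by blast
    then have "t ^ n \<le> onorm (T ^^ n)" "t \<ge> 0" using op_spectrum_power_bound[OF T n(1)] by auto
    then show "t \<le> root n (onorm (T ^^ n))"
      using n(1) real_root_le_iff[of n "t ^ n" "onorm (T ^^ n)"] by (simp add: real_root_power_cancel)
  qed (use False in blast)
  also have "\<dots> < 1" using n by simp
  finally show ?thesis using False unfolding spec_radius_def by simp
qed (simp add: spec_radius_def)

lemma spec_radius_less_oneD:
  fixes T :: "'a::banach \<Rightarrow> 'a"
  assumes T: "bounded_linear T" and "spec_radius T < 1" "norm l \<ge> 1"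
  shows "invertible_op (complexified_shift T l)"
proof (rule ccontr)
  assume "\<not> ?thesis"
  then have l: "l \<in> op_spectrum T" unfolding op_spectrum_def by simp
  \<comment> \<open>The real-valued \<open>Sup\<close> dominates the elements only of a set bounded
    above.\<close>
  have "bdd_above (norm ` op_spectrum T)"
    using op_spectrum_power_bound[OF T, of 1] by (intro bdd_aboveI[of _ "onorm T"]) auto
  then have "norm l \<le> Sup (norm ` op_spectrum T)" using l by (intro cSup_upper) auto
  then show False using assms l unfolding spec_radius_def by (auto split: if_splits)
qed

text \<open>For real \<open>m\<close> the complexified shift acts on each component separately as
  \<open>T - m\<close>. The first component of its inverse therefore gives the real resolvent, with
  a sign change since \<open>R\<close> inverts \<open>m - T\<close>.\<close>

lemma real_resolvent:
  fixes T :: "'a::banach \<Rightarrow> 'a"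
  assumes T: "bounded_linear T" and inv: "invertible_op (complexified_shift T (of_real m))"
  shows "\<exists>R. bounded_linear R \<and> (\<forall>x. R (m *\<^sub>R x - T x) = x) \<and> (\<forall>x. m *\<^sub>R R x - T (R x) = x)"
proof -
  interpret bounded_linear T by (rule T)
  obtain S where S: "bounded_linear S" "\<And>z. S (complexified_shift T (of_real m) z) = z"
    "\<And>z. complexified_shift T (of_real m) (S z) = z"
    using inv unfolding invertible_op_def by blast
  define R where "R x = fst (S (- x, 0))" for x
  have "bounded_linear R" unfolding R_def
    by (intro bounded_linear_compose[OF bounded_linear_fst] bounded_linear_compose[OF S(1)]
        bounded_linear_Pair bounded_linear_minus bounded_linear_ident bounded_linear_zero)
  moreover have "R (m *\<^sub>R x - T x) = x" for x
    using S(2)[of "(x, 0)"] by (simp add: complexified_shift_def R_def zero)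
  moreover have "m *\<^sub>R R x - T (R x) = x" for x
  proof -
    have "fst (complexified_shift T (of_real m) (S (- x, 0))) = - x" by (simp add: S(3))
    then have "T (R x) - m *\<^sub>R R x = - x"
      by (simp add: complexified_shift_def R_def case_prod_beta)
    then show ?thesis by (metis minus_diff_eq minus_minus)
  qed
  ultimately show ?thesis by blast
qed

section \<open>Positivity of the resolvent\<close>

lemma positive_inverse_if_spec_radius_less_one:
  fixes C :: "'a::banach set"
  assumes C: "ordered_banach_cone C" and T: "bounded_linear T" and pos: "positive_op C T"
    and r: "spec_radius T < 1"
  shows "bij (\<lambda>x. x - T x) \<and> (\<forall>x\<in>C. inv (\<lambda>x. x - T x) x \<in> C)"
proof -
  have "\<exists>R. m \<ge> 1 \<longrightarrow> bounded_linear R \<and> (\<forall>x. R (m *\<^sub>R x - T x) = x) \<and> (\<forall>x. m *\<^sub>R R x - T (R x) = x)"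
    for m :: real
    using real_resolvent[OF T spec_radius_less_oneD[OF T r], of m] by (cases "m \<ge> 1") auto
  then obtain R where "\<And>m::real. m \<ge> 1 \<longrightarrow>
      bounded_linear (R m) \<and> (\<forall>x. R m (m *\<^sub>R x - T x) = x) \<and> (\<forall>x. m *\<^sub>R R m x - T (R m x) = x)"
    by metis
  then have R: "bounded_linear (R m)" "R m (m *\<^sub>R x - T x) = x" "m *\<^sub>R R m x - T (R m x) = x"
    if "m \<ge> 1" for m x using that by auto
  have resolvent: "R m' x = R m x + (m - m') *\<^sub>R R m (R m' x)" if "m \<ge> 1" "m' \<ge> 1" for m m' x
  proof -
    interpret bounded_linear "R m" using that by (intro R)
    have "m *\<^sub>R R m' x - T (R m' x) = x + (m - m') *\<^sub>R R m' x"
      using R(3)[OF that(2), of x] by (simp add: algebra_simps)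
    then show ?thesis using R(2)[OF that(1), of "R m' x"] by (simp add: add scaleR)
  qed
  define P where "P m \<longleftrightarrow> (\<forall>x\<in>C. R m x \<in> C)" for m
  \<comment> \<open>The radius \<open>e\<close> depends on \<open>s\<close> alone and not on the
    starting point \<open>m\<close>. This matters below, where positivity is known only strictly
    above the infimum \<open>s\<close>.\<close>
  have local: "\<exists>e>0. \<forall>m m'. 1 \<le> m' \<longrightarrow> s - e \<le> m' \<longrightarrow> m' \<le> m \<longrightarrow> m \<le> s + e \<longrightarrow> P m \<longrightarrow> P m'"
    if s: "s \<ge> 1" for s
  proof -
    obtain B where B: "B > 0" "\<And>x. norm (R s x) \<le> norm x * B"
      using bounded_linear.pos_bounded[OF R(1)[OF s]] by blast
    \<comment> \<open>From \<open>\<bar>s - m\<bar> * B \<le> 1/8\<close> the factor is at most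
      \<open>8/7 * B\<close>, below \<open>2 * B\<close>. Two points of the neighbourhood differ by
      at most \<open>1 / (4 * B)\<close>, which makes the contraction constant
      \<open>1/2\<close>.\<close>
    have bound: "norm (R m x) \<le> 2 * B * norm x" if "m \<ge> 1" "\<bar>s - m\<bar> \<le> 1 / (8 * B)" for m x
    proof -
      have "norm (R m x) \<le> norm (R s x) + \<bar>s - m\<bar> * norm (R s (R m x))"
        using resolvent[OF s that(1), of x] norm_triangle_ineq[of "R s x" "(s - m) *\<^sub>R R s (R m x)"] by simp
      also have "\<dots> \<le> norm x * B + (1 / (8 * B)) * (norm (R m x) * B)"
        using B that(2) by (intro add_mono mult_mono) auto
      finally have "7 * norm (R m x) \<le> 8 * (B * norm x)" using B(1) by (simp add: field_simps)
      then show ?thesis using B(1) norm_ge_zero[of "R m x"] by linarith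
    qed
    have "P m'" if m: "1 \<le> m'" "s - 1 / (8 * B) \<le> m'" "m' \<le> m" "m \<le> s + 1 / (8 * B)" "P m" for m m'
      unfolding P_def
    proof
      fix x assume x: "x \<in> C"
      have m1: "m \<ge> 1" using m by simp
      show "R m' x \<in> C"
      proof (rule positive_contraction_fixpoint[OF C])
        show "bounded_linear (\<lambda>y. (m - m') *\<^sub>R R m y)"
          using R(1)[OF m1] by (rule bounded_linear_const_scaleR)
        show "(m - m') *\<^sub>R R m y \<in> C" if "y \<in> C" for y
          using that m cone_scale[OF C] unfolding P_def by simp
        show "norm ((m - m') *\<^sub>R R m w) \<le> 1/2 * norm w" for w
        proof -
          have "norm ((m - m') *\<^sub>R R m w) = (m - m') * norm (R m w)" using m by simp
          also have "\<dots> \<le> (1 / (4 * B)) * (2 * B * norm w)"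
          proof (rule mult_mono)
            show "m - m' \<le> 1 / (4 * B)" using m by (simp add: field_simps)
            show "norm (R m w) \<le> 2 * B * norm w"
              using m by (intro bound[OF m1]) (auto simp: abs_le_iff)
          qed (use B in auto)
          finally show ?thesis using B(1) by simp
        qed
        show "R m x \<in> C" using m(5) x unfolding P_def by blast
        show "R m' x = R m x + (m - m') *\<^sub>R R m (R m' x)" by (rule resolvent[OF m1 m(1)])
      qed auto
    qed
    then show ?thesis using B(1) by (intro exI[of _ "1 / (8 * B)"]) auto
  qed
  have large: "P m" if m: "m \<ge> onorm T + 1" for m
    unfolding P_def
  proof
    fix x assume x: "x \<in> C"
    have m1: "m \<ge> 1" "m > onorm T" using m onorm_pos_le[OF T] by auto
    show "R m x \<in> C"
    proof (rule positive_contraction_fixpoint[OF C])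
      show "bounded_linear (\<lambda>y. (1 / m) *\<^sub>R T y)" using T by (rule bounded_linear_const_scaleR)
      show "(1 / m) *\<^sub>R T y \<in> C" if "y \<in> C" for y
        using that m1 pos cone_scale[OF C] unfolding positive_op_def by (simp add: image_subset_iff)
      show "norm ((1 / m) *\<^sub>R T w) \<le> onorm T / m * norm w" for w
        using onorm[OF T, of w] m1 by (simp add: divide_right_mono)
      show "(1 / m) *\<^sub>R x \<in> C" using x m1 cone_scale[OF C] by simp
      have "m *\<^sub>R R m x = x + T (R m x)" using R(3)[OF m1(1), of x] by (simp add: algebra_simps)
      then have "(1 / m) *\<^sub>R (m *\<^sub>R R m x) = (1 / m) *\<^sub>R (x + T (R m x))" by simp
      then show "R m x = (1 / m) *\<^sub>R x + (1 / m) *\<^sub>R T (R m x)"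
        using m1 by (simp add: scaleR_add_right)
    qed (use m1 onorm_pos_le[OF T] in auto)
  qed
  define I where "I = {m. m \<ge> 1 \<and> (\<forall>m'\<ge>m. P m')}"
  define s where "s = Inf I"
  have I: "I \<noteq> {}" "bdd_below I"
  proof -
    have "onorm T + 1 \<in> I" using large onorm_pos_le[OF T] unfolding I_def by auto
    then show "I \<noteq> {}" by blast
    show "bdd_below I" unfolding I_def by (rule bdd_belowI[of _ 1]) auto
  qed
  have s1: "s \<ge> 1" unfolding s_def using I(1) by (rule cInf_greatest) (simp add: I_def)
  have above: "P m" if m: "m > s" for m
    using cInf_lessD[OF I(1), of m] m unfolding s_def I_def by auto
  obtain e where e: "e > 0" "\<And>m m'. 1 \<le> m' \<Longrightarrow> s - e \<le> m' \<Longrightarrow> m' \<le> m \<Longrightarrow> m \<le> s + e \<Longrightarrow> P m \<Longrightarrow> P m'"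
    using local[OF s1] by blast
  \<comment> \<open>Positivity at \<open>s + e\<close>, which lies above \<open>s\<close>, is
    carried down past \<open>s\<close>. As \<open>s\<close> is the infimum of \<open>I\<close>, this
    is possible only if the lower end has been cut off at 1, so \<open>1 \<in> I\<close>.\<close>
  have "max 1 (s - e) \<in> I"
  proof -
    have "P m'" if m': "m' \<ge> max 1 (s - e)" for m'
    proof (cases "m' > s")
      case False
      then show ?thesis using m' e(1) above[of "s + e"] by (intro e(2)[of m' "s + e"]) auto
    qed (rule above)
    then show ?thesis unfolding I_def by auto
  qed
  then have "s \<le> max 1 (s - e)" unfolding s_def using I(2) by (rule cInf_lower)
  then have "1 \<in> I" using \<open>max 1 (s - e) \<in> I\<close> s1 e(1) by (auto simp: max_def split: if_splits)
  then have P1: "P 1" unfolding I_def by simp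
  have inv: "R 1 (x - T x) = x" "R 1 x - T (R 1 x) = x" for x
    using R(2,3)[of 1 x] by auto
  have bij: "bij (\<lambda>x. x - T x)"
    by (rule o_bij[of "R 1"]) (auto simp: fun_eq_iff inv)
  have "inv (\<lambda>x. x - T x) x = R 1 x" for x
    by (rule inv_f_eq) (use bij inv in \<open>auto simp: bij_def\<close>)
  then show ?thesis using bij P1 unfolding P_def by simp
qed

section \<open>A nonzero superinvariant vector from a non-null orbit\<close>

lemma positive_orbit_sum:
  fixes C :: "'a::banach set"
  assumes C: "ordered_banach_cone C" and T: "bounded_linear T" and pos: "positive_op C T"
    and x: "x \<in> C" and s: "s \<ge> 0"
  shows "\<exists>y\<in>C. y - (T ^^ k) x \<in> C \<and> T y - s *\<^sub>R y = T ((T ^^ k) x) - s ^ Suc k *\<^sub>R x"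
  \<comment> \<open>The witness is \<open>\<Sum>i\<le>k. s ^ i *\<^sub>R (T ^^ (k - i)) x\<close>.\<close>
proof (induction k)
  case 0
  show ?case using x cone_zero[OF C] by (intro bexI[of _ x]) auto
next
  case (Suc k)
  interpret bounded_linear T by (rule T)
  have Tk: "(T ^^ n) x \<in> C" for n
    using x pos by (induction n) (auto simp: positive_op_def)
  obtain y where y: "y \<in> C" "T y - s *\<^sub>R y = T ((T ^^ k) x) - s ^ Suc k *\<^sub>R x"
    using Suc by blast
  let ?y = "(T ^^ Suc k) x + s *\<^sub>R y"
  have sy: "s *\<^sub>R y \<in> C" using y s cone_scale[OF C] by simp
  have "T ?y - s *\<^sub>R ?y = T ((T ^^ Suc k) x) + s *\<^sub>R (T y - s *\<^sub>R y - T ((T ^^ k) x))"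
    by (simp add: add scaleR algebra_simps)
  also have "\<dots> = T ((T ^^ Suc k) x) - s ^ Suc (Suc k) *\<^sub>R x" unfolding y(2) by simp
  finally show ?case using sy cone_add[OF C Tk[of "Suc k"] sy] by (intro bexI[of _ ?y]) auto
qed

lemma superinvariant_vector_if_orbit_not_null:
  fixes C :: "'a::banach set"
  assumes C: "ordered_banach_cone C" and T: "bounded_linear T" and pos: "positive_op C T"
    and qc: "quasi_compact T" and x: "x \<in> C" and nlim: "\<not> (\<lambda>k. (T ^^ k) x) \<longlonglongrightarrow> 0"
  shows "\<exists>u\<in>C. u \<noteq> 0 \<and> T u - u \<in> C"
proof -
  interpret bounded_linear T by (rule T)
  define b where "b k = norm ((T ^^ k) x)" for k
  have "\<not> b \<longlonglongrightarrow> 0" using nlim unfolding b_def by (simp add: tendsto_norm_zero_iff)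
  then obtain d where d: "d > 0" "\<And>m. \<exists>k\<ge>m. \<forall>i\<le>k. d * b i \<le> b k"
    using frequently_almost_record[of b] unfolding b_def by (metis norm_ge_zero)
  have x0: "x \<noteq> 0"
  proof
    assume "x = 0"
    then have "(T ^^ k) x = 0" for k by (induction k) (auto simp: zero)
    then show False using nlim by simp
  qed
  have Tk: "(T ^^ n) x \<in> C" for n
    using x pos by (induction n) (auto simp: positive_op_def)
  \<comment> \<open>Each \<open>s j\<close> is below 1, so its powers can be made small; the limit 1
    turns approximate solutions for \<open>T - s j\<close> into one for
    \<open>T - id\<close>.\<close>
  define s where "s j = 1 - inverse (real (Suc j))" for j
  have s: "0 \<le> s j" "s j < 1" for j unfolding s_def by (auto simp: field_simps)
  have s_lim: "s \<longlonglongrightarrow> 1" unfolding s_def using tendsto_diff[OF tendsto_const LIMSEQ_inverse_real_of_nat] by simp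
  have "\<exists>k\<ge>j. s j ^ Suc k \<le> inverse (real (Suc j)) \<and> (\<forall>i\<le>k. d * b i \<le> b k)" for j
  proof -
    obtain m where m: "s j ^ m < inverse (real (Suc j))"
      using real_arch_pow_inv[of "inverse (real (Suc j))" "s j"] s[of j] by auto
    obtain k where k: "k \<ge> max m j" "\<forall>i\<le>k. d * b i \<le> b k" using d(2) by blast
    have "s j ^ Suc k \<le> s j ^ m" using k(1) s[of j] by (intro power_decreasing) auto
    then show ?thesis using k m by (intro exI[of _ k]) auto
  qed
  then obtain k where k: "\<And>j. k j \<ge> j" "\<And>j. s j ^ Suc (k j) \<le> inverse (real (Suc j))"
    "\<And>j i. i \<le> k j \<Longrightarrow> d * b i \<le> b (k j)" by metis
  define c where "c j = b (k j)" for j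
  \<comment> \<open>Comparing with index 0 keeps the normalising constants away from 0, so that the
    error term tends to 0 after division by \<open>c j\<close>.\<close>
  have c_ge: "c j \<ge> d * b 0" for j unfolding c_def using k(3)[of 0] by simp
  have db: "d * b 0 > 0" using d(1) x0 by (simp add: b_def)
  have c0: "c j > 0" for j using c_ge[of j] db by simp
  define v where "v j = (1 / c j) *\<^sub>R (T ^^ k j) x" for j
  have v_norm: "norm (v j) = 1" for j using c0[of j] unfolding v_def c_def b_def by simp
  have v_C: "v j \<in> C" for j unfolding v_def using c0[of j] Tk cone_scale[OF C] by (simp add: less_imp_le)
  obtain v0 r1 where r1: "strict_mono r1" and v0: "(v \<circ> r1) \<longlonglongrightarrow> v0"
  proof (rule subseq_convergent_if_totally_bounded[of v])
    fix e :: real assume "e > 0"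
    then obtain n F where F: "finite F" "\<And>z. norm z \<le> 1 / d \<Longrightarrow> \<exists>p\<in>F. norm ((T ^^ n) z - p) < e"
      using quasi_compact_cover[OF T qc, of e "1 / d"] by metis
    \<comment> \<open>The almost-record property bounds \<open>T ^^ (k j - n)\<close> at
      \<open>x\<close> by \<open>c j / d\<close>, so \<open>v j\<close> is the image under
      \<open>T ^^ n\<close> of a vector of norm at most \<open>1 / d\<close>.\<close>
    have "\<exists>p\<in>F. norm (v j - p) < e" if "j \<ge> n" for j
    proof -
      have n: "n \<le> k j" using that k(1)[of j] by simp
      interpret Tn: bounded_linear "T ^^ n" by (rule bounded_linear_funpow[OF T])
      have "T ^^ k j = T ^^ n \<circ> T ^^ (k j - n)" using n by (simp flip: funpow_add)
      then have "v j = (T ^^ n) ((1 / c j) *\<^sub>R (T ^^ (k j - n)) x)" by (simp add: v_def Tn.scaleR)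
      moreover have "norm ((1 / c j) *\<^sub>R (T ^^ (k j - n)) x) \<le> 1 / d"
        using k(3)[of "k j - n" j] c0[of j] d(1) unfolding b_def c_def by (simp add: field_simps)
      ultimately show ?thesis using F(2) by simp
    qed
    then show "\<exists>F. finite F \<and> (\<forall>\<^sub>F j in sequentially. \<exists>p\<in>F. norm (v j - p) < e)"
      using F(1) unfolding eventually_sequentially by blast
  qed
  have "\<exists>y\<in>C. y - v j \<in> C \<and> T y - s j *\<^sub>R y = T (v j) - (s j ^ Suc (k j) / c j) *\<^sub>R x" for j
  proof -
    obtain y where y: "y \<in> C" "y - (T ^^ k j) x \<in> C"
      "T y - s j *\<^sub>R y = T ((T ^^ k j) x) - s j ^ Suc (k j) *\<^sub>R x"
      using positive_orbit_sum[OF C T pos x s(1)] by metis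
    have "T ((1 / c j) *\<^sub>R y) - s j *\<^sub>R ((1 / c j) *\<^sub>R y) = (1 / c j) *\<^sub>R (T y - s j *\<^sub>R y)"
      by (simp add: scaleR algebra_simps)
    also have "\<dots> = T (v j) - (s j ^ Suc (k j) / c j) *\<^sub>R x"
      unfolding y(3) v_def by (simp add: scaleR scaleR_diff_right)
    finally have eq: "T ((1 / c j) *\<^sub>R y) - s j *\<^sub>R ((1 / c j) *\<^sub>R y) =
        T (v j) - (s j ^ Suc (k j) / c j) *\<^sub>R x" .
    have "(1 / c j) *\<^sub>R y - v j = (1 / c j) *\<^sub>R (y - (T ^^ k j) x)"
      unfolding v_def by (simp add: scaleR_diff_right)
    moreover have "(1 / c j) *\<^sub>R z \<in> C" if "z \<in> C" for z
      using that c0[of j] cone_scale[OF C] by (simp add: less_imp_le)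
    ultimately show ?thesis using y eq by (intro bexI[of _ "(1 / c j) *\<^sub>R y"]) auto
  qed
  then obtain y where y: "\<And>j. y j \<in> C" "\<And>j. y j - v j \<in> C"
    "\<And>j. T (y j) - s j *\<^sub>R y j = T (v j) - (s j ^ Suc (k j) / c j) *\<^sub>R x" by metis
  txt \<open>Dividing by \<open>1 + norm (y j)\<close> treats bounded and unbounded \<open>y\<close> at once: if \<open>t0 > 0\<close>, the
    limit vector dominates \<open>t0 *\<^sub>R v0\<close>; if \<open>t0 = 0\<close>, it has norm 1 and is fixed by \<open>T\<close>.\<close>
  define t where "t j = 1 / (1 + norm (y j))" for j
  have t: "t j \<in> {0..1}" for j unfolding t_def by (simp add: divide_le_eq_1 add_pos_nonneg)
  define u where "u j = t j *\<^sub>R y j" for j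
  have u_norm: "norm (u j) = 1 - t j" for j
  proof -
    have "1 + norm (y j) \<noteq> 0" by (smt (verit) norm_ge_zero)
    then show ?thesis unfolding u_def t_def by (simp add: field_simps)
  qed
  have u_C: "u j \<in> C" "u j - t j *\<^sub>R v j \<in> C" for j
    using cone_scale[OF C, of "t j"] y(1,2)[of j] t[of j] unfolding u_def
    by (auto simp flip: scaleR_diff_right)
  obtain t0 r2 where r2: "strict_mono r2" and t0: "((t \<circ> r1) \<circ> r2) \<longlonglongrightarrow> t0" "t0 \<in> {0..1}"
    using compact_Icc[of "0::real" 1] t unfolding compact_def by (metis comp_apply)
  define r where "r = r1 \<circ> r2"
  have r: "strict_mono r" unfolding r_def using r1 r2 by (rule strict_mono_o)
  have v_r: "(\<lambda>j. v (r j)) \<longlonglongrightarrow> v0" using LIMSEQ_subseq_LIMSEQ[OF v0 r2] by (simp add: r_def o_def)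
  have t_r: "(\<lambda>j. t (r j)) \<longlonglongrightarrow> t0" using t0 by (simp add: r_def o_def)
  have s_r: "(\<lambda>j. s (r j)) \<longlonglongrightarrow> 1" using LIMSEQ_subseq_LIMSEQ[OF s_lim r] by (simp add: o_def)
  have err: "(\<lambda>j. s j ^ Suc (k j) / c j) \<longlonglongrightarrow> 0"
  proof (rule Lim_null_comparison)
    show "\<forall>\<^sub>F j in sequentially. norm (s j ^ Suc (k j) / c j) \<le> inverse (real (Suc j)) / (d * b 0)"
    proof (intro always_eventually allI)
      fix j
      have "norm (s j ^ Suc (k j) / c j) = s j ^ Suc (k j) / c j" using s[of j] c0[of j] by simp
      also have "\<dots> \<le> inverse (real (Suc j)) / (d * b 0)"
        using k(2)[of j] c_ge[of j] db by (intro frac_le) auto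
      finally show "norm (s j ^ Suc (k j) / c j) \<le> inverse (real (Suc j)) / (d * b 0)" .
    qed
    show "(\<lambda>j. inverse (real (Suc j)) / (d * b 0)) \<longlonglongrightarrow> 0"
      by (rule tendsto_divide_zero[OF LIMSEQ_inverse_real_of_nat])
  qed
  have err_r: "(\<lambda>j. s (r j) ^ Suc (k (r j)) / c (r j)) \<longlonglongrightarrow> 0"
    using LIMSEQ_subseq_LIMSEQ[OF err r] by (simp add: o_def)
  \<comment> \<open>Replacing the factor \<open>s j\<close> by 1 costs
    \<open>(s j - 1) *\<^sub>R u j\<close>, which vanishes in the limit because the
    \<open>u j\<close> are bounded.\<close>
  have "T (u j) - u j = t j *\<^sub>R (T (v j) - (s j ^ Suc (k j) / c j) *\<^sub>R x) + (s j - 1) *\<^sub>R u j" for j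
    unfolding y(3)[symmetric] u_def by (simp add: scaleR algebra_simps)
  moreover have "(\<lambda>j. (s (r j) - 1) *\<^sub>R u (r j)) \<longlonglongrightarrow> 0"
  proof (rule Lim_null_comparison)
    show "\<forall>\<^sub>F j in sequentially. norm ((s (r j) - 1) *\<^sub>R u (r j)) \<le> \<bar>s (r j) - 1\<bar>"
      using u_norm t by (intro always_eventually allI) (simp add: mult_left_le)
    show "(\<lambda>j. \<bar>s (r j) - 1\<bar>) \<longlonglongrightarrow> 0" using s_r by (simp add: LIM_zero tendsto_rabs_zero)
  qed
  ultimately have Tu: "(\<lambda>j. T (u (r j)) - u (r j)) \<longlonglongrightarrow> t0 *\<^sub>R (T v0 - 0 *\<^sub>R x) + 0"
    using t_r err_r tendsto[OF v_r]
    by (simp only:) (intro tendsto_intros)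
  have "norm (u (r j)) \<le> 1" for j using u_norm[of "r j"] t[of "r j"] by simp
  then obtain u0 r3 where r3: "strict_mono r3" and u0: "((\<lambda>j. u (r j)) \<circ> r3) \<longlonglongrightarrow> u0"
    using quasi_compact_asymptotic_fixed_subseq[OF T qc _ Tu] by metis
  have u_q: "(\<lambda>j. u (r (r3 j))) \<longlonglongrightarrow> u0" using u0 by (simp add: o_def)
  have t_q: "(\<lambda>j. t (r (r3 j))) \<longlonglongrightarrow> t0" using LIMSEQ_subseq_LIMSEQ[OF t_r r3] by (simp add: o_def)
  have v_q: "(\<lambda>j. v (r (r3 j))) \<longlonglongrightarrow> v0" using LIMSEQ_subseq_LIMSEQ[OF v_r r3] by (simp add: o_def)
  have lim_C: "l \<in> C" if "f \<longlonglongrightarrow> l" "\<And>j. f j \<in> C" for f :: "nat \<Rightarrow> 'a" and l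
    using that cone_closed[OF C] by (meson closed_sequentially)
  have u0_C: "u0 \<in> C" using lim_C[OF u_q] u_C by blast
  have v0_C: "v0 \<in> C" using lim_C[OF v_r] v_C by blast
  have "T u0 - u0 = t0 *\<^sub>R T v0"
  proof (rule LIMSEQ_unique)
    show "(\<lambda>j. T (u (r (r3 j))) - u (r (r3 j))) \<longlonglongrightarrow> T u0 - u0"
      by (intro tendsto_diff tendsto u_q)
    show "(\<lambda>j. T (u (r (r3 j))) - u (r (r3 j))) \<longlonglongrightarrow> t0 *\<^sub>R T v0"
      using LIMSEQ_subseq_LIMSEQ[OF Tu r3] by (simp add: o_def)
  qed
  moreover have "t0 *\<^sub>R T v0 \<in> C"
    using v0_C pos t0(2) cone_scale[OF C] unfolding positive_op_def by (simp add: image_subset_iff)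
  \<comment> \<open>If \<open>u0 = 0\<close>, the norms force \<open>t0 = 1\<close>, and
    \<open>u j \<ge> t j *\<^sub>R v j\<close> becomes \<open>0 \<ge> v0\<close> in the limit.
    Pointedness then gives \<open>v0 = 0\<close>, although \<open>v0\<close> is a limit of unit
    vectors.\<close>
  moreover have "u0 \<noteq> 0"
  proof
    assume "u0 = 0"
    have "(\<lambda>j. norm (u (r (r3 j)))) \<longlonglongrightarrow> 1 - t0" unfolding u_norm by (intro tendsto_intros t_q)
    then have "norm u0 = 1 - t0" using tendsto_norm[OF u_q] LIMSEQ_unique by blast
    then have "t0 = 1" using \<open>u0 = 0\<close> by simp
    have "(\<lambda>j. u (r (r3 j)) - t (r (r3 j)) *\<^sub>R v (r (r3 j))) \<longlonglongrightarrow> u0 - t0 *\<^sub>R v0"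
      by (intro tendsto_intros u_q t_q v_q)
    then have "u0 - t0 *\<^sub>R v0 \<in> C" using lim_C u_C(2) by blast
    then have "- v0 \<in> C" using \<open>u0 = 0\<close> \<open>t0 = 1\<close> by simp
    then have "v0 = 0" using v0_C cone_pointed[OF C] by blast
    moreover have "norm v0 = 1"
      using tendsto_norm[OF v_r] v_norm LIMSEQ_unique[OF _ tendsto_const] by auto
    ultimately show False by simp
  qed
  ultimately show ?thesis using u0_C by (intro bexI[of _ u0]) auto
qed

section \<open>The cycle of implications\<close>

theorem theorem3p14:
  fixes C :: "('a::banach) set" and T :: "'a \<Rightarrow> 'a"
  assumes "ordered_banach_cone C" and "total_cone C"
    and "bounded_linear T" and "positive_op C T" and "quasi_compact T"
  shows "(spec_radius T < 1 \<longleftrightarrow>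
            (bij (\<lambda>x. x - T x) \<and> (\<forall>x\<in>C. inv (\<lambda>x. x - T x) x \<in> C)))
       \<and> (spec_radius T < 1 \<longleftrightarrow> (\<forall>x. x - T x \<in> C \<longrightarrow> x \<in> C))
       \<and> (spec_radius T < 1 \<longleftrightarrow> (\<forall>x\<in>C. x \<noteq> 0 \<longrightarrow> T x - x \<notin> C))
       \<and> (spec_radius T < 1 \<longleftrightarrow> (\<forall>x\<in>C. (\<lambda>k. (T ^^ k) x) \<longlonglongrightarrow> 0))
       \<and> (spec_radius T < 1 \<longleftrightarrow> (\<forall>x\<in>C. (INF k. norm ((T ^^ k) x)) = 0))"
    (is "(?i \<longleftrightarrow> ?ii) \<and> (_ \<longleftrightarrow> ?iii) \<and> (_ \<longleftrightarrow> ?iv) \<and> (_ \<longleftrightarrow> ?v) \<and> (_ \<longleftrightarrow> ?vi)")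
proof -
  note C = assms(1) and T = assms(3) and pos = assms(4) and qc = assms(5)
  interpret bounded_linear T by (rule T)
  have Tpos: "T x \<in> C" if "x \<in> C" for x using that pos unfolding positive_op_def by blast
  have "?i \<Longrightarrow> ?ii" using positive_inverse_if_spec_radius_less_one[OF C T pos] .
  moreover have "?ii \<Longrightarrow> ?iii"
  proof (intro allI impI)
    fix x assume ii: "?ii" and x: "x - T x \<in> C"
    then have "inv (\<lambda>x. x - T x) (x - T x) \<in> C" by blast
    then show "x \<in> C" using inv_f_f[OF bij_is_inj[OF conjunct1[OF ii]], of x] by simp
  qed
  moreover have "?iii \<Longrightarrow> ?iv"
  proof (intro ballI impI notI)
    fix x assume iii: "?iii" and "x \<in> C" "x \<noteq> 0" "T x - x \<in> C"
    \<comment> \<open>A superinvariant \<open>x\<close> makes \<open>- x\<close> a vector to which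
      (iii) applies.\<close>
    have "- x - T (- x) \<in> C" using \<open>T x - x \<in> C\<close> by (simp add: neg)
    then have "- x \<in> C" using iii by blast
    then show False using \<open>x \<in> C\<close> \<open>x \<noteq> 0\<close> cone_pointed[OF C] by blast
  qed
  moreover have "?iv \<Longrightarrow> ?v"
    using superinvariant_vector_if_orbit_not_null[OF C T pos qc] by blast
  moreover have "?v \<Longrightarrow> ?i"
  proof -
    assume v: ?v
    let ?D = "{x - y | x y. x \<in> C \<and> y \<in> C}"
    have lim: "(\<lambda>k. (T ^^ k) z) \<longlonglongrightarrow> 0" if z: "z \<in> ?D" for z
    proof -
      obtain x y where xy: "z = x - y" "x \<in> C" "y \<in> C" using z by blast
      have "(T ^^ k) z = (T ^^ k) x - (T ^^ k) y" for k
        unfolding xy(1) by (rule linear_diff[OF bounded_linear.linear[OF bounded_linear_funpow[OF T]]])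
      moreover have "(\<lambda>k. (T ^^ k) x - (T ^^ k) y) \<longlonglongrightarrow> 0 - 0"
        using v xy by (intro tendsto_diff) auto
      ultimately show ?thesis by simp
    qed
    have "closure ?D = UNIV" using assms(2) unfolding total_cone_def .
    then obtain n where "n \<ge> 1" "onorm (T ^^ n) < 1"
      using quasi_compact_power_contraction[OF T qc _ lim] by blast
    then show ?i by (rule spec_radius_less_oneI[OF T])
  qed
  moreover have "?v \<Longrightarrow> ?vi"
  proof
    fix x assume v: "?v" and "x \<in> C"
    then have lim: "(\<lambda>k. norm ((T ^^ k) x)) \<longlonglongrightarrow> 0" by (intro tendsto_norm_zero) blast
    have bdd: "bdd_below (range (\<lambda>k. norm ((T ^^ k) x)))" by (rule bdd_belowI[of _ 0]) auto
    show "(INF k. norm ((T ^^ k) x)) = 0"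
    proof (rule antisym)
      show "(INF k. norm ((T ^^ k) x)) \<le> 0"
        using lim by (rule tendsto_lowerbound) (auto intro!: always_eventually cINF_lower bdd)
      show "0 \<le> (INF k. norm ((T ^^ k) x))" by (rule cINF_greatest) auto
    qed
  qed
  moreover have "?vi \<Longrightarrow> ?iv"
  proof (intro ballI impI notI)
    fix x assume vi: "?vi" and x: "x \<in> C" "x \<noteq> 0" "T x - x \<in> C"
    have Tk: "(T ^^ k) x - x \<in> C" for k
    proof (induction k)
      case 0
      show ?case using cone_zero[OF C] by simp
    next
      case (Suc k)
      have "T ((T ^^ k) x - x) + (T x - x) \<in> C" using Tpos[OF Suc] x(3) by (rule cone_add[OF C])
      then show ?case by (simp add: diff)
    qed
    \<comment> \<open>Superinvariance iterates to \<open>(T ^^ k) x - x \<in> C\<close>. Where the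
      orbit comes close to 0, these vectors come close to \<open>- x\<close>, so closedness puts
      \<open>- x\<close> into \<open>C\<close>.\<close>
    have "\<exists>y\<in>C. dist y (- x) < e" if "e > 0" for e
    proof -
      have "(INF k. norm ((T ^^ k) x)) < e" using vi x(1) that by simp
      then obtain k where "norm ((T ^^ k) x) < e"
        using cInf_lessD[of "range (\<lambda>k. norm ((T ^^ k) x))" e] by auto
      then show ?thesis using Tk[of k] by (intro bexI[of _ "(T ^^ k) x - x"]) (auto simp: dist_norm)
    qed
    then have "- x \<in> closure C" by (simp add: closure_approachable)
    then show False using x cone_pointed[OF C] cone_closed[OF C] by simp
  qed
  ultimately show ?thesis by satx
qed

end
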